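(* For every integer $n \geq 2$ the following statements are equivalent: (a) $f_2(n+1,n^2) = n^2+n$; (b) $f_2(n+1,n^2) \leq n^2+n$; (c) there is a projective plane of order $n$.
   Context: Graphs are finite and simple with nonempty vertex set. A clique of a graph is a set of pairwise adjacent vertices (sets with at most one vertex are cliques); a clique is maximal if it is maximal with respect to inclusion, and $c(G)$ is the number of maximal cliques of $G$. For integers $t\geq2$ and $m\geq1$, $f_2(t,m)$ is the minimum of $\sum_{i=1}^t c(G_i)$ over all factorizations of the complete graph $K_m$ into $t$ edge-disjoint spanning subgraphs $G_1,\dots,G_t$ (all on the same $m$ vertices, some possibly edgeless, whose edge sets partition the edge set of $K_m$). A projective plane of order $n$ ($n\ge2$) is the usual finite (nondegenerate) projective plane in which every line has $n+1$ points. *)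

theory Defs
  imports "HOL-Library.Ramsey" "HOL-Library.Disjoint_Sets"
begin

text \<open>
  A finite simple graph is a finite nonempty vertex set \<open>V\<close> with an edge set \<open>E \<subseteq> [V]\<^bsup>2\<^esup>\<close>.
  The constant \<^const>\<open>clique\<close> from \<^theory>\<open>HOL-Library.Ramsey\<close> says that the elements of its
  first argument are pairwise adjacent with respect to the edge set in its second argument.
\<close>

definition maximal_cliques :: "'a set \<Rightarrow> 'a set set \<Rightarrow> 'a set set" where
  "maximal_cliques V E =
     {C. C \<subseteq> V \<and> clique C E \<and> (\<forall>D. D \<subseteq> V \<and> clique D E \<and> C \<subseteq> D \<longrightarrow> D = C)}"

definition num_maximal_cliques :: "'a set \<Rightarrow> 'a set set \<Rightarrow> nat" where
  "num_maximal_cliques V E = card (maximal_cliques V E)"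

text \<open>
  The factors are the graphs with vertex set \<open>V\<close> and edge sets \<open>F 1, \<dots>, F t\<close>. As some of these
  may be empty, \<^const>\<open>partition_on\<close> does not apply.
\<close>

definition complete_factorization :: "'a set \<Rightarrow> nat \<Rightarrow> (nat \<Rightarrow> 'a set set) \<Rightarrow> bool" where
  "complete_factorization V t F \<longleftrightarrow>
     (\<Union>i\<in>{1..t}. F i) = [V]\<^bsup>2\<^esup> \<and> disjoint_family_on F {1..t}"

definition f2 :: "nat \<Rightarrow> nat \<Rightarrow> nat" where
  "f2 t m = (LEAST s. \<exists>F. complete_factorization {..<m} t F \<and>
                          s = (\<Sum>i=1..t. num_maximal_cliques {..<m} (F i)))"

text \<open>For \<open>t \<ge> 1\<close> factorizations exist, so the minimum is attained.\<close>

lemma complete_factorization_exists: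
  assumes "t \<ge> 1"
  shows "\<exists>F. complete_factorization V t F"
proof
  show "complete_factorization V t (\<lambda>i. if i = 1 then [V]\<^bsup>2\<^esup> else {})"
    using assms by (auto simp: complete_factorization_def disjoint_family_on_def split: if_splits)
qed

lemma f2_attained:
  assumes "t \<ge> 1"
  shows "\<exists>F. complete_factorization {..<m} t F \<and>
             f2 t m = (\<Sum>i=1..t. num_maximal_cliques {..<m} (F i))"
  unfolding f2_def by (rule LeastI_ex) (use complete_factorization_exists[OF assms] in blast)

lemma f2_le:
  assumes "complete_factorization {..<m} t F"
  shows "f2 t m \<le> (\<Sum>i=1..t. num_maximal_cliques {..<m} (F i))"
  unfolding f2_def by (rule Least_le) (use assms in blast)

text \<open>Lines are identified with their sets of points.\<close>

locale projective_plane =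
  fixes points :: "'a set" and lines :: "'a set set" and n :: nat
  assumes finite_points: "finite points"
    and lines_subset: "l \<in> lines \<Longrightarrow> l \<subseteq> points"
    and unique_line: "\<lbrakk>p \<in> points; q \<in> points; p \<noteq> q\<rbrakk> \<Longrightarrow> \<exists>!l. l \<in> lines \<and> p \<in> l \<and> q \<in> l"
    and unique_meet: "\<lbrakk>l \<in> lines; k \<in> lines; l \<noteq> k\<rbrakk> \<Longrightarrow> \<exists>!p. p \<in> l \<and> p \<in> k"
    and quadrangle: "\<exists>Q \<subseteq> points. card Q = 4 \<and> (\<forall>l \<in> lines. card (l \<inter> Q) \<le> 2)"
    and card_line: "l \<in> lines \<Longrightarrow> card l = n + 1"

text \<open>Finiteness makes it harmless to take the points of the plane to be natural numbers.\<close>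

definition exists_projective_plane :: "nat \<Rightarrow> bool" where
  "exists_projective_plane n \<longleftrightarrow> (\<exists>P L. projective_plane (P :: nat set) L n)"

lemma projective_plane_image:
  assumes "projective_plane P L n" and inj: "inj_on g P"
  shows "projective_plane (g ` P) ((`) g ` L) n"
proof -
  interpret projective_plane P L n by fact
  have mem: "g x \<in> g ` l \<longleftrightarrow> x \<in> l" if "x \<in> P" "l \<in> L" for x l
    using inj_on_image_mem_iff[OF inj] that lines_subset by blast
  have int: "g ` A \<inter> g ` B = g ` (A \<inter> B)" if "A \<subseteq> P" "B \<subseteq> P" for A B
    using inj_on_image_Int[OF inj that] by simp
  have card: "card (g ` A) = card A" if "A \<subseteq> P" for A
    using card_image[OF inj_on_subset[OF inj that]] .
  show ?thesis
  proof
    show "finite (g ` P)" using finite_points by simp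
  next
    fix l assume "l \<in> (`) g ` L"
    then show "l \<subseteq> g ` P" using lines_subset by auto
  next
    fix p q assume "p \<in> g ` P" "q \<in> g ` P" "p \<noteq> q"
    then obtain x y where xy: "p = g x" "q = g y" "x \<in> P" "y \<in> P" "x \<noteq> y" by blast
    obtain l where l: "l \<in> L" "x \<in> l" "y \<in> l"
        and u: "\<And>k. k \<in> L \<Longrightarrow> x \<in> k \<Longrightarrow> y \<in> k \<Longrightarrow> k = l"
      using unique_line[OF xy(3-5)] by blast
    show "\<exists>!l. l \<in> (`) g ` L \<and> p \<in> l \<and> q \<in> l"
    proof (rule ex1I[of _ "g ` l"])
      show "g ` l \<in> (`) g ` L \<and> p \<in> g ` l \<and> q \<in> g ` l" using l xy by blast
    next
      fix k assume k: "k \<in> (`) g ` L \<and> p \<in> k \<and> q \<in> k"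
      then obtain k' where k': "k' \<in> L" "k = g ` k'" by blast
      then show "k = g ` l" using k mem u xy by metis
    qed
  next
    fix l k assume "l \<in> (`) g ` L" "k \<in> (`) g ` L" "l \<noteq> k"
    then obtain l' k' where lk: "l = g ` l'" "k = g ` k'" "l' \<in> L" "k' \<in> L" "l' \<noteq> k'" by blast
    then obtain x where "l' \<inter> k' = {x}" using unique_meet[OF lk(3-5)] by blast
    then have "l \<inter> k = {g x}" using int lk lines_subset by simp
    then show "\<exists>!p. p \<in> l \<and> p \<in> k" by (simp flip: Int_iff)
  next
    obtain Q where Q: "Q \<subseteq> P" "card Q = 4" "\<forall>l \<in> L. card (l \<inter> Q) \<le> 2"
      using quadrangle by blast
    have "card (g ` l \<inter> g ` Q) \<le> 2" if "l \<in> L" for l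
    proof -
      have "card (g ` l \<inter> g ` Q) = card (l \<inter> Q)"
        using int[OF lines_subset[OF that] Q(1)] card[of "l \<inter> Q"] Q(1) by auto
      then show ?thesis using Q(3) that by simp
    qed
    then show "\<exists>Q \<subseteq> g ` P. card Q = 4 \<and> (\<forall>l \<in> (`) g ` L. card (l \<inter> Q) \<le> 2)"
      using Q card by (intro exI[of _ "g ` Q"]) auto
  next
    fix l assume "l \<in> (`) g ` L"
    then show "card l = n + 1" using card card_line lines_subset by auto
  qed
qed

lemma exists_projective_planeI:
  assumes "projective_plane P L n"
  shows "exists_projective_plane n"
proof -
  have "finite P" using assms by (rule projective_plane.finite_points)
  then obtain g :: "'a \<Rightarrow> nat" where "inj_on g P"
    using finite_imp_inj_to_nat_seg by metis
  then show ?thesis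
    unfolding exists_projective_plane_def using projective_plane_image[OF assms] by blast
qed

end

theory Submission
  imports Defs Complex_Main
begin

text \<open>
  Let every maximal clique \<open>C\<close> of a graph distribute one unit of weight equally over its vertices.
  The number of maximal cliques is then the total weight received by the vertices. A vertex \<open>v\<close> of
  degree \<open>d\<close> lies in some maximal clique, which has at most \<open>d + 1\<close> vertices, so \<open>v\<close> receives at least
  \<open>1 / (d + 1)\<close>. In a factorization of the complete graph on \<open>n\<^sup>2\<close> vertices into \<open>n + 1\<close> factors the
  \<open>n + 1\<close> degrees of a fixed vertex add up to \<open>n\<^sup>2 - 1 = (n + 1) (n - 1)\<close>, so by convexity of \<open>1 / x\<close>
  the vertex receives at least \<open>(n + 1) / n\<close> in total, and the factors together have at least
  \<open>n\<^sup>2 \<cdot> (n + 1) / n = n\<^sup>2 + n\<close> maximal cliques. Convexity enters as the tangent line of \<open>1 / x\<close> at \<open>x = n\<close>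
  (\<open>inverse_ge_tangent\<close>), because this turns the bound into one for each vertex and factor separately
  (\<open>clique_weight_ge_tangent\<close>) and so makes the case of equality immediate: if there are
  just \<open>n\<^sup>2 + n\<close>, then in every factor each vertex lies in exactly one maximal clique, and this clique has
  \<open>n\<close> vertices (\<open>factorization_bound\<close>).

  Such an extremal factorization is an affine plane of order \<open>n\<close>: the lines are the maximal cliques,
  and each factor is a parallel class. Adding one point at infinity for each factor and a line at
  infinity gives a projective plane (\<open>projective_plane_of_extremal_factorization\<close>). Conversely, a
  projective plane without the points of one line \<open>l\<^sub>0\<close> has \<open>n\<^sup>2\<close> points. Colour a pair of these
  points by the point in which the line joining them meets \<open>l\<^sub>0\<close>. Each of the \<open>n + 1\<close> colour classes
  is then a disjoint union of \<open>n\<close> complete graphs (\<open>parallel_class_factorization\<close>), which attains the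
  bound.
\<close>

section \<open>Weighting the maximal cliques\<close>

lemma mem_pairs_iff: "{u, v} \<in> [V]\<^bsup>2\<^esup> \<longleftrightarrow> u \<in> V \<and> v \<in> V \<and> u \<noteq> v"
  by (auto simp: nsets_def card_2_iff doubleton_eq_iff)

lemma exists_distinct:
  assumes "2 \<le> card A"
  shows "\<exists>a\<in>A. \<exists>b\<in>A. a \<noteq> b"
proof -
  obtain T where "T \<subseteq> A" "card T = 2" using obtain_subset_with_card_n[OF assms] by blast
  then show ?thesis by (auto simp: card_2_iff)
qed

lemma finite_maximal_cliques: "finite V \<Longrightarrow> finite (maximal_cliques V E)"
  by (rule finite_subset[of _ "Pow V"]) (auto simp: maximal_cliques_def)

lemma maximal_cliqueD:
  assumes "C \<in> maximal_cliques V E"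
  shows "C \<subseteq> V" "clique C E"
  using assms by (auto simp: maximal_cliques_def)

lemma clique_extends_to_maximal:
  assumes "finite V" "C \<subseteq> V" "clique C E"
  shows "\<exists>D \<in> maximal_cliques V E. C \<subseteq> D"
proof -
  let ?A = "{D. D \<subseteq> V \<and> clique D E}"
  have "finite ?A" by (rule finite_subset[of _ "Pow V"]) (use assms in auto)
  moreover have "C \<in> ?A" using assms by simp
  ultimately obtain D where D: "D \<in> ?A" "C \<subseteq> D" "\<forall>B\<in>?A. D \<subseteq> B \<longrightarrow> D = B"
    by (rule finite_has_maximal2[elim_format]) (elim bexE conjE)
  then have "D \<in> maximal_cliques V E" by (auto simp: maximal_cliques_def)
  with D(2) show ?thesis by blast
qed

lemma vertex_in_maximal_clique:
  assumes "finite V" "v \<in> V"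
  shows "\<exists>D \<in> maximal_cliques V E. v \<in> D"
  using clique_extends_to_maximal[of V "{v}" E] assms by (auto simp: clique_def)

text \<open>In the graph without vertices the empty set is a maximal clique.\<close>

lemma maximal_clique_nonempty:
  assumes "V \<noteq> {}" "C \<in> maximal_cliques V E"
  shows "C \<noteq> {}"
proof
  assume C: "C = {}"
  obtain v where "v \<in> V" using assms by blast
  then have "{v} \<subseteq> V \<and> clique {v} E \<and> C \<subseteq> {v}" using C by (auto simp: clique_def)
  then have "{v} = C" using assms(2) unfolding maximal_cliques_def by blast
  then show False using C by simp
qed

text \<open>
  This is the weight that \<open>v\<close> receives when each maximal clique spreads one unit over its vertices.
\<close>

definition clique_weight :: "'a set \<Rightarrow> 'a set set \<Rightarrow> 'a \<Rightarrow> real" where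
  "clique_weight V E v = (\<Sum>C \<in> {C \<in> maximal_cliques V E. v \<in> C}. 1 / card C)"

lemma num_maximal_cliques_eq_sum_weight:
  assumes "finite V" "V \<noteq> {}"
  shows "real (num_maximal_cliques V E) = (\<Sum>v\<in>V. clique_weight V E v)"
proof -
  let ?M = "maximal_cliques V E"
  have "(\<Sum>v | v \<in> V \<and> v \<in> C. 1 / real (card C)) = 1" if "C \<in> ?M" for C
  proof -
    have "{v. v \<in> V \<and> v \<in> C} = C" using maximal_cliqueD(1)[OF that] by auto
    moreover have "card C > 0"
      using maximal_clique_nonempty[OF assms(2) that] maximal_cliqueD(1)[OF that] assms(1)
      by (auto simp: card_gt_0_iff intro: finite_subset)
    ultimately show ?thesis by simp
  qed
  then have "(\<Sum>C\<in>?M. \<Sum>v | v \<in> V \<and> v \<in> C. 1 / real (card C)) = (\<Sum>C\<in>?M. 1)"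
    by (rule sum.cong[OF refl])
  then have "real (num_maximal_cliques V E) = (\<Sum>C\<in>?M. \<Sum>v | v \<in> V \<and> v \<in> C. 1 / real (card C))"
    by (simp only: num_maximal_cliques_def real_of_card)
  also have "\<dots> = (\<Sum>v\<in>V. clique_weight V E v)"
    unfolding clique_weight_def
    using sum.swap_restrict[OF finite_maximal_cliques[OF assms(1)] assms(1)] by fast
  finally show ?thesis .
qed

text \<open>
  The closed neighbourhood is preferred to the degree because its size \<open>d + 1\<close> is what bounds a
  clique and what the tangent line is evaluated at.
\<close>

definition closed_nbhd :: "'a set \<Rightarrow> 'a set set \<Rightarrow> 'a \<Rightarrow> 'a set" where
  "closed_nbhd V E v = {u \<in> V. u = v \<or> {u, v} \<in> E}"

lemma clique_subset_closed_nbhd: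
  assumes "clique C E" "C \<subseteq> V" "v \<in> C"
  shows "C \<subseteq> closed_nbhd V E v"
  using assms by (auto simp: closed_nbhd_def clique_def)

text \<open>
  The difference of the two sides is \<open>(x - a)\<^sup>2 / (a\<^sup>2 x)\<close>, and \<open>2 / a - x / a\<^sup>2\<close> is the tangent line of
  \<open>1 / x\<close> at \<open>a\<close>.
\<close>

lemma inverse_ge_tangent:
  fixes x a :: real
  assumes "x > 0" "a > 0"
  shows "2 / a - x / a\<^sup>2 \<le> 1 / x" and "1 / x = 2 / a - x / a\<^sup>2 \<Longrightarrow> x = a"
proof -
  have *: "1 / x - (2 / a - x / a\<^sup>2) = (x - a)\<^sup>2 / (a\<^sup>2 * x)"
    using assms by (simp add: field_simps power2_eq_square)
  moreover have "(x - a)\<^sup>2 / (a\<^sup>2 * x) \<ge> 0" using assms by simp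
  ultimately show "2 / a - x / a\<^sup>2 \<le> 1 / x" by linarith
  show "x = a" if "1 / x = 2 / a - x / a\<^sup>2" using that * assms by auto
qed

text \<open>
  One maximal clique through \<open>v\<close> already contributes \<open>1 / |C| \<ge> 1 / |N[v]|\<close>, which lies above the
  tangent line. If the bound is attained, there is no contribution from a second clique and the
  tangent point is hit, that is, \<open>|C| = |N[v]| = n\<close>.
\<close>

lemma clique_weight_ge_tangent:
  assumes V: "finite V" "v \<in> V" and "n > 0"
  shows "2 / n - card (closed_nbhd V E v) / (real n)\<^sup>2 \<le> clique_weight V E v" (is "?t \<le> _")
    and "\<lbrakk>clique_weight V E v \<le> 2 / n - card (closed_nbhd V E v) / (real n)\<^sup>2;
          C \<in> maximal_cliques V E; v \<in> C; D \<in> maximal_cliques V E; v \<in> D\<rbrakk> \<Longrightarrow> C = D \<and> card D = n"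
proof -
  let ?N = "closed_nbhd V E v" and ?M = "{C \<in> maximal_cliques V E. v \<in> C}"
  have finM: "finite ?M" using finite_maximal_cliques[OF V(1)] by simp
  have finN: "finite ?N" using V by (simp add: closed_nbhd_def)
  have bounds: "0 < card C" "card C \<le> card ?N" if "C \<in> ?M" for C
  proof -
    have "C \<subseteq> V" "clique C E" "v \<in> C" using that by (auto dest: maximal_cliqueD)
    then show "0 < card C" using V by (auto simp: card_gt_0_iff intro: finite_subset)
    show "card C \<le> card ?N"
      by (rule card_mono[OF finN clique_subset_closed_nbhd]) fact+
  qed
  have split: "clique_weight V E v = 1 / card D + (\<Sum>C \<in> ?M - {D}. 1 / card C)" if "D \<in> ?M" for D
    unfolding clique_weight_def by (rule sum.remove[OF finM that])
  have D_ge: "1 / real (card ?N) \<le> 1 / card D" if "D \<in> ?M" for D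
    using bounds[OF that] by (simp add: frac_le)
  have rest: "(\<Sum>C \<in> ?M - {D}. 1 / real (card C)) \<ge> 0" for D by (simp add: sum_nonneg)
  obtain D0 where D0: "D0 \<in> ?M" using vertex_in_maximal_clique[OF V] by blast
  have N: "real (card ?N) > 0" using bounds[OF D0] by linarith
  have tangent: "?t \<le> 1 / card ?N" using inverse_ge_tangent(1)[OF N, of n] assms by simp
  show "?t \<le> clique_weight V E v" using split[OF D0] D_ge[OF D0] rest[of D0] tangent by linarith
  assume le: "clique_weight V E v \<le> ?t" and "C \<in> maximal_cliques V E" "v \<in> C"
    and "D \<in> maximal_cliques V E" "v \<in> D"
  then have C: "C \<in> ?M" and D: "D \<in> ?M" by simp_all
  have eq: "1 / card ?N = ?t" "1 / real (card D) = 1 / card ?N"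
      "(\<Sum>C \<in> ?M - {D}. 1 / real (card C)) = 0"
    using le split[OF D] D_ge[OF D] rest[of D] tangent by linarith+
  have "card ?N = n" using inverse_ge_tangent(2)[OF N _ eq(1)] assms by simp
  then have "card D = n" using eq(2) by simp
  moreover have "C = D"
  proof (rule ccontr)
    assume "C \<noteq> D"
    then have C': "C \<in> ?M - {D}" using C by simp
    have "(\<Sum>C \<in> ?M - {D}. 1 / real (card C)) > 0"
      by (rule sum_pos2[OF _ C']) (use finM C' bounds in auto)
    then show False using eq(3) by simp
  qed
  ultimately show "C = D \<and> card D = n" by simp
qed

section \<open>The lower bound and its extremal factorizations\<close>

text \<open>
  Each of the other \<open>card V - 1\<close> vertices is adjacent to \<open>v\<close> in exactly one factor, and \<open>v\<close> belongs to
  its own closed neighbourhood in all \<open>t\<close> factors.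
\<close>

lemma sum_card_closed_nbhd:
  assumes "finite V" "v \<in> V" "complete_factorization V t F"
  shows "(\<Sum>i=1..t. card (closed_nbhd V (F i) v)) + 1 = card V + t"
proof -
  let ?A = "\<lambda>i. {u \<in> V. {u, v} \<in> F i}"
  have F: "(\<Union>i\<in>{1..t}. F i) = [V]\<^bsup>2\<^esup>" "disjoint_family_on F {1..t}"
    using assms by (auto simp: complete_factorization_def)
  have edge: "(\<exists>i\<in>{1..t}. {u, v} \<in> F i) \<longleftrightarrow> u \<in> V \<and> v \<in> V \<and> u \<noteq> v" for u
    using F(1) mem_pairs_iff[of u v V] by blast
  have N: "card (closed_nbhd V (F i) v) = card (?A i) + 1" if "i \<in> {1..t}" for i
  proof -
    have "closed_nbhd V (F i) v = insert v (?A i)" using assms by (auto simp: closed_nbhd_def)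
    moreover have "v \<notin> ?A i" using edge[of v] that by auto
    ultimately show ?thesis using assms by simp
  qed
  have "(\<Union>i\<in>{1..t}. ?A i) = V - {v}" using edge assms(2) by auto
  moreover have "?A i \<inter> ?A j = {}" if "i \<in> {1..t}" "j \<in> {1..t}" "i \<noteq> j" for i j
    using disjoint_family_onD[OF F(2) that] by blast
  ultimately have "card (V - {v}) = (\<Sum>i=1..t. card (?A i))"
    using card_UN_disjoint[of "{1..t}" ?A] assms(1) by simp
  then have "(\<Sum>i=1..t. card (closed_nbhd V (F i) v)) = card (V - {v}) + t"
    using N by (simp only: sum.distrib sum_constant cong: sum.cong) simp
  moreover have "card V = card (V - {v}) + 1" using assms card_Suc_Diff1[of V v] by simp
  ultimately show ?thesis by simp
qed

text \<open>
  The tangent bounds are linear in the closed neighbourhood sizes, so they can be summed exactly: over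
  all factors and vertices they give \<open>n\<^sup>2 + n\<close>. The excess of the clique count over \<open>n\<^sup>2 + n\<close> is thus
  the sum of the nonnegative local slacks, and if it vanishes, so does every one of them.
\<close>

lemma factorization_bound:
  assumes V: "finite V" "card V = n\<^sup>2" and n: "n > 0"
    and F: "complete_factorization V (n + 1) F"
  shows "n\<^sup>2 + n \<le> (\<Sum>i=1..n + 1. num_maximal_cliques V (F i))" (is "_ \<le> ?c")
    and "\<lbrakk>(\<Sum>i=1..n + 1. num_maximal_cliques V (F i)) \<le> n\<^sup>2 + n; i \<in> {1..n + 1};
          C \<in> maximal_cliques V (F i); v \<in> C; D \<in> maximal_cliques V (F i); v \<in> D\<rbrakk> \<Longrightarrow>
           C = D \<and> card D = n"
proof -
  let ?w = "\<lambda>i v. clique_weight V (F i) v"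
  let ?t = "\<lambda>i v. 2 / n - card (closed_nbhd V (F i) v) / (real n)\<^sup>2"
  have "V \<noteq> {}" using V n by auto
  then have c: "real ?c = (\<Sum>i=1..n + 1. \<Sum>v\<in>V. ?w i v)"
    using num_maximal_cliques_eq_sum_weight[OF V(1)] by simp
  have t_vertex: "(\<Sum>i=1..n + 1. ?t i v) = (n + 1) / n" if "v \<in> V" for v
  proof -
    have "(\<Sum>i=1..n + 1. card (closed_nbhd V (F i) v)) = n * (n + 1)"
      using sum_card_closed_nbhd[OF V(1) that F] V(2) by (simp add: power2_eq_square)
    then have "(\<Sum>i=1..n + 1. real (card (closed_nbhd V (F i) v))) = n * (n + 1)"
      by (metis of_nat_sum)
    then have "(\<Sum>i=1..n + 1. ?t i v) = (n + 1) * (2 / n) - n * (n + 1) / (real n)\<^sup>2"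
      by (simp add: sum_subtractf flip: sum_divide_distrib)
    also have "\<dots> = (n + 1) / n" using n by (simp add: field_simps power2_eq_square)
    finally show ?thesis .
  qed
  have t: "(\<Sum>i=1..n + 1. \<Sum>v\<in>V. ?t i v) = n\<^sup>2 + n"
  proof -
    have "(\<Sum>i=1..n + 1. \<Sum>v\<in>V. ?t i v) = (\<Sum>v\<in>V. \<Sum>i=1..n + 1. ?t i v)"
      by (rule sum.swap)
    also have "\<dots> = (\<Sum>v\<in>V. (n + 1) / n)" by (rule sum.cong[OF refl t_vertex])
    also have "\<dots> = n\<^sup>2 + n" using n V(2) by (simp add: power2_eq_square field_simps)
    finally show ?thesis .
  qed
  define slack where "slack i v = ?w i v - ?t i v" for i v
  have slack_nonneg: "0 \<le> slack i v" if "v \<in> V" for i v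
    unfolding slack_def using clique_weight_ge_tangent(1)[OF V(1) that n, of "F i"] by linarith
  have excess: "(\<Sum>i=1..n + 1. \<Sum>v\<in>V. slack i v) = real ?c - (n\<^sup>2 + n)"
    using c t by (simp only: slack_def sum_subtractf of_nat_add)
  have nonneg: "0 \<le> (\<Sum>i=1..n + 1. \<Sum>v\<in>V. slack i v)"
    by (intro sum_nonneg slack_nonneg)
  show "n\<^sup>2 + n \<le> ?c" using excess nonneg by linarith
  assume le: "?c \<le> n\<^sup>2 + n" and i: "i \<in> {1..n + 1}"
    and CD: "C \<in> maximal_cliques V (F i)" "v \<in> C" "D \<in> maximal_cliques V (F i)" "v \<in> D"
  have v: "v \<in> V" using maximal_cliqueD(1) CD by blast
  have "(\<Sum>i=1..n + 1. \<Sum>v\<in>V. slack i v) = 0" using excess nonneg le by linarith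
  then have "(\<Sum>v\<in>V. slack i v) = 0"
    by (rule sum_nonneg_0[OF finite_atLeastAtMost _ _ i, rotated])
      (intro sum_nonneg slack_nonneg)
  then have "slack i v = 0"
    by (rule sum_nonneg_0[OF V(1) _ _ v, rotated]) (rule slack_nonneg)
  then have "?w i v \<le> ?t i v" by (simp only: slack_def)
  then show "C = D \<and> card D = n"
    by (rule clique_weight_ge_tangent(2)[OF V(1) v n _ CD])
qed

section \<open>From an extremal factorization to a projective plane\<close>

text \<open>
  The points are the vertices (\<open>Inl\<close>) and one point at infinity for each factor (\<open>Inr\<close>). That lines
  from different parallel classes meet is the only axiom that needs counting: a line of one class has
  \<open>n\<close> points, which lie on different lines of the other class, and this class has just \<open>n\<close> lines.
\<close>

lemma projective_plane_of_extremal_factorization: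
  fixes V :: "'a set"
  assumes V: "finite V" "card V = n\<^sup>2" and n: "n \<ge> 2"
    and F: "complete_factorization V (n + 1) F"
    and extremal: "\<And>i C D v. \<lbrakk>i \<in> {1..n + 1}; C \<in> maximal_cliques V (F i); v \<in> C;
          D \<in> maximal_cliques V (F i); v \<in> D\<rbrakk> \<Longrightarrow> C = D \<and> card D = n"
  shows "\<exists>(P :: ('a + nat) set) L. projective_plane P L n"
proof -
  let ?I = "{1..n + 1}"
  define M where "M i = maximal_cliques V (F i)" for i
  define line where "line i C = insert (Inr i) (Inl ` C)" for i :: nat and C :: "'a set"
  define infinity where "infinity = (Inr ` ?I :: ('a + nat) set)"
  define P where "P = Inl ` V \<union> infinity"
  define L where "L = insert infinity {line i C | i C. i \<in> ?I \<and> C \<in> M i}"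
  have nonempty: "V \<noteq> {}" using V n by auto
  have F_union: "(\<Union>i\<in>?I. F i) = [V]\<^bsup>2\<^esup>" and F_disj: "disjoint_family_on F ?I"
    using F by (auto simp: complete_factorization_def)
  have M_sub: "C \<subseteq> V" if "C \<in> M i" for i C using that maximal_cliqueD(1) M_def by blast
  have M_edge: "{u, v} \<in> F i" if "C \<in> M i" "u \<in> C" "v \<in> C" "u \<noteq> v" for i C u v
    using that maximal_cliqueD(2) unfolding M_def clique_def by blast
  have M_ex: "\<exists>C. C \<in> M i \<and> v \<in> C" if "i \<in> ?I" "v \<in> V" for i v
    using vertex_in_maximal_clique[OF V(1) that(2), of "F i"] M_def by blast
  have M_unique: "C = D" if "i \<in> ?I" "C \<in> M i" "D \<in> M i" "v \<in> C" "v \<in> D" for i C D v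
    using extremal[of i C v D] that by (simp add: M_def)
  have M_card: "card C = n" if "i \<in> ?I" "C \<in> M i" for i C
  proof -
    have "C \<noteq> {}" using maximal_clique_nonempty[OF nonempty] that by (simp add: M_def)
    then show ?thesis using extremal[of i C _ C] that by (auto simp: M_def)
  qed
  \<comment> \<open>Two common points would span an edge lying in both factors.\<close>
  have M_cross: "u = v"
    if "i \<in> ?I" "j \<in> ?I" "i \<noteq> j" "C \<in> M i" "D \<in> M j" "u \<in> C" "u \<in> D" "v \<in> C" "v \<in> D" for i j C D u v
    using M_edge[of C i u v] M_edge[of D j u v] disjoint_family_onD[OF F_disj that(1-3)] that by blast
  have finite_M: "finite (M i)" for i using finite_maximal_cliques[OF V(1)] M_def by simp
  have card_M: "card (M i) = n" if "i \<in> ?I" for i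
  proof -
    have M_Un: "\<Union> (M i) = V" using M_ex[OF that] M_sub by blast
    have "n * card (M i) = card (\<Union> (M i))"
    proof (rule card_partition)
      show "finite (M i)" by (fact finite_M)
      show "finite (\<Union> (M i))" using M_Un V by simp
      show "card C = n" if "C \<in> M i" for C using M_card \<open>i \<in> ?I\<close> that .
      show "C \<inter> D = {}" if "C \<in> M i" "D \<in> M i" "C \<noteq> D" for C D
        using M_unique[OF \<open>i \<in> ?I\<close> that(1,2)] that(3) by blast
    qed
    then show ?thesis using M_Un V n by (simp add: power2_eq_square)
  qed
  have M_meet: "\<exists>v. v \<in> C \<and> v \<in> D" if ij: "i \<in> ?I" "j \<in> ?I" "i \<noteq> j" and CD: "C \<in> M i" "D \<in> M j"
    for i j C D
  proof -
    have "\<exists>g. \<forall>v\<in>D. g v \<in> M i \<and> v \<in> g v"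
      using M_ex[OF ij(1)] M_sub[OF CD(2)] by (intro bchoice) blast
    then obtain g where g: "\<And>v. v \<in> D \<Longrightarrow> g v \<in> M i \<and> v \<in> g v" by blast
    have "inj_on g D" using g M_cross[OF ij _ CD(2)] by (intro inj_onI) metis
    then have "card (g ` D) = card (M i)" using card_image M_card[OF ij(2) CD(2)] card_M[OF ij(1)] by metis
    moreover have "g ` D \<subseteq> M i" using g by blast
    ultimately have "g ` D = M i" using card_subset_eq[OF finite_M] by blast
    then show ?thesis using CD g by blast
  qed
  have mem_simps: "Inl v \<in> line i C \<longleftrightarrow> v \<in> C" "Inr j \<in> line i C \<longleftrightarrow> j = i"
      "Inl v \<notin> infinity" "Inr j \<in> infinity \<longleftrightarrow> j \<in> ?I"
      "Inl v \<in> P \<longleftrightarrow> v \<in> V" "Inr j \<in> P \<longleftrightarrow> j \<in> ?I" for v i j C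
    by (auto simp: line_def infinity_def P_def)
  have L_cases: "l = infinity \<or> (\<exists>i C. i \<in> ?I \<and> C \<in> M i \<and> l = line i C)" if "l \<in> L" for l
    using that L_def by blast
  have L_intros: "infinity \<in> L" "\<And>i C. i \<in> ?I \<Longrightarrow> C \<in> M i \<Longrightarrow> line i C \<in> L"
    unfolding L_def by blast+
  have affine_line: "\<exists>!l. l \<in> L \<and> Inl u \<in> l \<and> Inl v \<in> l" if uv: "u \<in> V" "v \<in> V" "u \<noteq> v" for u v
  proof -
    obtain i where i: "i \<in> ?I" "{u, v} \<in> F i" using uv F_union mem_pairs_iff[of u v V] by blast
    have "clique {u, v} (F i)" using i by (auto simp: clique_def insert_commute)
    then have "\<exists>C \<in> M i. {u, v} \<subseteq> C"
      unfolding M_def by (rule clique_extends_to_maximal[OF V(1), rotated]) (use uv in simp)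
    then obtain C where C: "C \<in> M i" "u \<in> C" "v \<in> C" by blast
    show ?thesis
    proof (rule ex1I[of _ "line i C"])
      show "line i C \<in> L \<and> Inl u \<in> line i C \<and> Inl v \<in> line i C"
        using L_intros i C mem_simps by simp
      fix l assume l: "l \<in> L \<and> Inl u \<in> l \<and> Inl v \<in> l"
      then obtain j D where D: "j \<in> ?I" "D \<in> M j" "l = line j D" "u \<in> D" "v \<in> D"
        using L_cases mem_simps by metis
      then have "j = i" using M_cross[OF D(1) i(1) _ D(2) C(1)] C uv by blast
      then show "l = line i C" using D C M_unique by blast
    qed
  qed
  have direction_line: "\<exists>!l. l \<in> L \<and> Inl v \<in> l \<and> Inr i \<in> l" if v: "v \<in> V" and i: "i \<in> ?I" for v i
  proof -
    obtain C where C: "C \<in> M i" "v \<in> C" using M_ex v i by blast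
    show ?thesis
    proof (rule ex1I[of _ "line i C"])
      show "line i C \<in> L \<and> Inl v \<in> line i C \<and> Inr i \<in> line i C"
        using L_intros i C mem_simps by simp
      fix l assume l: "l \<in> L \<and> Inl v \<in> l \<and> Inr i \<in> l"
      then obtain j D where D: "j \<in> ?I" "D \<in> M j" "l = line j D" "v \<in> D" "i = j"
        using L_cases mem_simps by metis
      then show "l = line i C" using C M_unique by blast
    qed
  qed
  have infinity_line: "\<exists>!l. l \<in> L \<and> Inr i \<in> l \<and> Inr j \<in> l" if "i \<in> ?I" "j \<in> ?I" "i \<noteq> j" for i j
  proof (rule ex1I[of _ infinity])
    show "infinity \<in> L \<and> Inr i \<in> infinity \<and> Inr j \<in> infinity"
      using L_intros mem_simps that by simp
    show "l = infinity" if "l \<in> L \<and> Inr i \<in> l \<and> Inr j \<in> l" for l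
      using that L_cases mem_simps \<open>i \<noteq> j\<close> by metis
  qed
  have meet_infinity: "\<exists>!p. p \<in> infinity \<and> p \<in> line i C" if "i \<in> ?I" for i C
  proof (rule ex1I[of _ "Inr i"])
    show "Inr i \<in> infinity \<and> Inr i \<in> line i C" using mem_simps that by simp
    show "p = Inr i" if "p \<in> infinity \<and> p \<in> line i C" for p
      using that mem_simps by (cases p) auto
  qed
  have meet_affine: "\<exists>!p. p \<in> line i C \<and> p \<in> line j D"
    if ij: "i \<in> ?I" "j \<in> ?I" and CD: "C \<in> M i" "D \<in> M j" and ne: "line i C \<noteq> line j D" for i j C D
  proof (cases "i = j")
    case True
    then have "v \<notin> D" if "v \<in> C" for v using M_unique[OF ij(1) CD(1), of D v] CD ne that by blast
    then have "p = Inr i" if "p \<in> line i C \<and> p \<in> line j D" for p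
      using that mem_simps by (cases p) auto
    moreover have "Inr i \<in> line i C \<and> Inr i \<in> line j D" using True mem_simps by simp
    ultimately show ?thesis by blast
  next
    case False
    obtain v where v: "v \<in> C" "v \<in> D" using M_meet[OF ij False CD] by blast
    show ?thesis
    proof (rule ex1I[of _ "Inl v"])
      show "Inl v \<in> line i C \<and> Inl v \<in> line j D" using v mem_simps by simp
      show "p = Inl v" if "p \<in> line i C \<and> p \<in> line j D" for p
        using that mem_simps M_cross[OF ij False CD _ _ v] False by (cases p) auto
    qed
  qed
  have quadrangle: "\<exists>Q \<subseteq> P. card Q = 4 \<and> (\<forall>l \<in> L. card (l \<inter> Q) \<le> 2)"
  proof -
    \<comment> \<open>Take two points at infinity and two points of an affine line with a third direction;
        there are at least three directions.\<close>
    have I: "1 \<in> ?I" "2 \<in> ?I" "3 \<in> ?I" using n by auto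
    obtain C where C: "C \<in> M 3" using nonempty M_ex[OF I(3)] by blast
    have "2 \<le> card C" using M_card[OF I(3) C] n by simp
    then obtain u v where uv: "u \<in> C" "v \<in> C" "u \<noteq> v"
      using exists_distinct by blast
    let ?Q = "{Inr 1, Inr 2, Inl u, Inl v} :: ('a + nat) set"
    have "card (l \<inter> ?Q) \<le> 2" if l: "l \<in> L" for l
    proof -
      have two: "\<exists>a b. l \<inter> ?Q \<subseteq> {a, b}"
      proof (cases "l = infinity")
        case True
        then have "l \<inter> ?Q \<subseteq> {Inr 1, Inr 2}" using mem_simps by auto
        then show ?thesis by blast
      next
        case False
        then obtain i D where D: "i \<in> ?I" "D \<in> M i" "l = line i D" using L_cases l by blast
        show ?thesis
        proof (cases "i = 3")
          case True
          then have "l \<inter> ?Q \<subseteq> {Inl u, Inl v}" using mem_simps D by auto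
          then show ?thesis by blast
        next
          case False
          then have "u \<notin> D \<or> v \<notin> D"
            using M_cross[OF D(1) I(3) False D(2) C, of u v] uv by blast
          then have "l \<inter> ?Q \<subseteq> {Inr i, Inl u} \<or> l \<inter> ?Q \<subseteq> {Inr i, Inl v}"
            using mem_simps D by auto
          then show ?thesis by blast
        qed
      qed
      then obtain a b where "l \<inter> ?Q \<subseteq> {a, b}" by blast
      then have "card (l \<inter> ?Q) \<le> card {a, b}" by (intro card_mono) auto
      also have "\<dots> \<le> 2" by (simp add: card_insert_if)
      finally show ?thesis .
    qed
    moreover have "?Q \<subseteq> P" using mem_simps I M_sub[OF C] uv by auto
    moreover have "card ?Q = 4" using uv by simp
    ultimately show ?thesis by blast
  qed
  have "projective_plane P L n"
  proof
    show "finite P" using V by (simp add: P_def infinity_def)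
  next
    fix l assume "l \<in> L"
    then show "l \<subseteq> P" using L_cases[of l] M_sub by (fastforce simp: P_def line_def infinity_def)
  next
    fix p q assume pq: "p \<in> P" "q \<in> P" "p \<noteq> q"
    show "\<exists>!l. l \<in> L \<and> p \<in> l \<and> q \<in> l"
    proof (cases p; cases q)
      fix u v assume "p = Inl u" "q = Inl v"
      then show ?thesis using affine_line pq mem_simps by simp
    next
      fix u i assume "p = Inl u" "q = Inr i"
      then show ?thesis using direction_line pq mem_simps by simp
    next
      fix i u assume "p = Inr i" "q = Inl u"
      then show ?thesis using direction_line[of u i] pq mem_simps by (simp add: conj_commute)
    next
      fix i j assume "p = Inr i" "q = Inr j"
      then show ?thesis using infinity_line pq mem_simps by simp
    qed
  next
    fix l k assume lk: "l \<in> L" "k \<in> L" "l \<noteq> k"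
    consider "l = infinity" | "k = infinity" | "l \<noteq> infinity" "k \<noteq> infinity" by blast
    then show "\<exists>!p. p \<in> l \<and> p \<in> k"
    proof cases
      case 1
      then show ?thesis using lk L_cases[of k] meet_infinity by metis
    next
      case 2
      then show ?thesis using lk L_cases[of l] meet_infinity by metis
    next
      case 3
      then show ?thesis using lk L_cases[of l] L_cases[of k] meet_affine by metis
    qed
  next
    show "\<exists>Q \<subseteq> P. card Q = 4 \<and> (\<forall>l \<in> L. card (l \<inter> Q) \<le> 2)" by (fact quadrangle)
  next
    fix l assume l: "l \<in> L"
    have "card (line i C) = n + 1" if "i \<in> ?I" "C \<in> M i" for i C
    proof -
      have "finite C" using M_sub[OF that(2)] V finite_subset by blast
      moreover have "Inr i \<notin> Inl ` C" by blast
      ultimately show ?thesis using M_card[OF that] by (simp add: line_def card_image)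
    qed
    moreover have "card infinity = n + 1" by (simp add: infinity_def card_image)
    ultimately show "card l = n + 1" using L_cases[OF l] by metis
  qed
  then show ?thesis by blast
qed

section \<open>From a projective plane to a factorization\<close>

context projective_plane
begin

lemma finite_lines: "finite lines"
  by (rule finite_subset[of _ "Pow points"]) (use finite_points lines_subset in auto)

lemma finite_line: "l \<in> lines \<Longrightarrow> finite l"
  using lines_subset finite_points finite_subset by blast

lemma line_eqI:
  assumes "l \<in> lines" "k \<in> lines" "p \<noteq> q" "p \<in> l" "p \<in> k" "q \<in> l" "q \<in> k"
  shows "l = k"
  using unique_meet[OF assms(1,2)] assms by blast

text \<open>The lines through \<open>p\<close>, without \<open>p\<close> itself, partition the other points into sets of size \<open>n\<close>.\<close>

lemma card_points_eq_pencil: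
  assumes p: "p \<in> points"
  shows "card points = n * card {l \<in> lines. p \<in> l} + 1"
proof -
  let ?A = "(\<lambda>l. l - {p}) ` {l \<in> lines. p \<in> l}"
  have "inj_on (\<lambda>l. l - {p}) {l \<in> lines. p \<in> l}" by (rule inj_onI) blast
  then have card_A: "card ?A = card {l \<in> lines. p \<in> l}" by (rule card_image)
  have A_Un: "\<Union> ?A = points - {p}"
  proof (intro subset_antisym subsetI)
    show "q \<in> points - {p}" if "q \<in> \<Union> ?A" for q using that lines_subset by blast
    show "q \<in> \<Union> ?A" if q: "q \<in> points - {p}" for q
    proof -
      obtain l where "l \<in> lines" "p \<in> l" "q \<in> l" using unique_line[OF p, of q] q by blast
      then show ?thesis using q by blast
    qed
  qed
  have "n * card ?A = card (\<Union> ?A)"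
  proof (rule card_partition)
    show "finite ?A" using finite_lines by simp
    show "finite (\<Union> ?A)" using A_Un finite_points by simp
    show "card c = n" if "c \<in> ?A" for c using that card_line finite_line by auto
    show "c1 \<inter> c2 = {}" if c: "c1 \<in> ?A" "c2 \<in> ?A" and ne: "c1 \<noteq> c2" for c1 c2
    proof (rule ccontr)
      assume "c1 \<inter> c2 \<noteq> {}"
      then obtain q where q: "q \<in> c1" "q \<in> c2" by blast
      obtain l k where lk: "l \<in> lines" "p \<in> l" "c1 = l - {p}" "k \<in> lines" "p \<in> k" "c2 = k - {p}"
        using c by blast
      then have "l = k" using line_eqI[of l k p q] q by blast
      then show False using lk ne by simp
    qed
  qed
  then show ?thesis using A_Un card_A finite_points p card_Suc_Diff1[OF finite_points p] by simp
qed

text \<open>Joining \<open>p\<close> to the points of \<open>l\<close> gives each line through \<open>p\<close> exactly once.\<close>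

lemma card_pencil_off_line:
  assumes p: "p \<in> points" and l: "l \<in> lines" "p \<notin> l"
  shows "card {k \<in> lines. p \<in> k} = n + 1"
proof -
  define join where "join q = (THE k. k \<in> lines \<and> p \<in> k \<and> q \<in> k)" for q
  have join: "join q \<in> lines" "p \<in> join q" "q \<in> join q" if "q \<in> l" for q
  proof -
    have "q \<in> points" "p \<noteq> q" using that l lines_subset by blast+
    then show "join q \<in> lines" "p \<in> join q" "q \<in> join q"
      using theI'[OF unique_line[OF p]] unfolding join_def by blast+
  qed
  have "bij_betw join l {k \<in> lines. p \<in> k}"
  proof (rule bij_betwI')
    show "join q = join r \<longleftrightarrow> q = r" if "q \<in> l" "r \<in> l" for q r
      using join[OF that(1)] join[OF that(2)] line_eqI[OF l(1), of "join q" q r] l that by metis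
    show "join q \<in> {k \<in> lines. p \<in> k}" if "q \<in> l" for q using join[OF that] by blast
    show "\<exists>q\<in>l. k = join q" if k: "k \<in> {k \<in> lines. p \<in> k}" for k
    proof -
      obtain q where q: "q \<in> l" "q \<in> k" using unique_meet[of l k] l k by blast
      then show ?thesis using join[OF q(1)] line_eqI[of k "join q" p q] k l by blast
    qed
  qed
  then show ?thesis using bij_betw_same_card card_line[OF l(1)] by fastforce
qed

lemma exists_point_off_line: "l \<in> lines \<Longrightarrow> \<exists>p \<in> points. p \<notin> l"
proof -
  assume l: "l \<in> lines"
  obtain Q where Q: "Q \<subseteq> points" "card Q = 4" "card (l \<inter> Q) \<le> 2" using quadrangle l by blast
  then have "l \<inter> Q \<noteq> Q" by (intro notI) simp
  then show ?thesis using Q by blast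
qed

lemma exists_line: "\<exists>l. l \<in> lines"
proof -
  obtain Q where Q: "Q \<subseteq> points" "card Q = 4" using quadrangle by blast
  then have "2 \<le> card Q" by simp
  then obtain p q where "p \<in> Q" "q \<in> Q" "p \<noteq> q"
    using exists_distinct by blast
  then show ?thesis using unique_line Q by blast
qed

lemma card_points: "card points = n\<^sup>2 + n + 1"
proof -
  obtain l where l: "l \<in> lines" using exists_line by blast
  obtain p where "p \<in> points" "p \<notin> l" using exists_point_off_line[OF l] by blast
  then show ?thesis
    using card_points_eq_pencil[of p] card_pencil_off_line[of p l] l by (simp add: power2_eq_square)
qed

lemma card_pencil:
  assumes "p \<in> points" "n > 0"
  shows "card {l \<in> lines. p \<in> l} = n + 1"
proof -
  have "n * card {l \<in> lines. p \<in> l} = n * (n + 1)"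
    using card_points_eq_pencil[OF assms(1)] card_points by (simp add: power2_eq_square)
  then show ?thesis by (simp only: mult_cancel1) (use assms(2) in simp)
qed

text \<open>
  Deleting the line \<open>l0\<close> leaves an affine plane on \<open>V\<close>, in which the points \<open>b i\<close> of \<open>l0\<close> name the
  parallel classes. A maximal clique of the factor \<open>F i\<close> is the affine part of a line through \<open>b i\<close>,
  because such a line is determined by \<open>b i\<close> and any vertex of the clique. There are \<open>n\<close> such lines
  other than \<open>l0\<close>. As a lower bound on the number of cliques is available already, it is enough that
  there are at most \<open>n\<close> of them.
\<close>

lemma parallel_class_factorization:
  assumes n: "n > 0" and l0: "l0 \<in> lines" and b: "bij_betw b {1..n + 1} l0"
  defines "V \<equiv> points - l0"
  defines "F \<equiv> \<lambda>i. {e \<in> [V]\<^bsup>2\<^esup>. \<exists>l \<in> lines. b i \<in> l \<and> e \<subseteq> l}"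
  shows "complete_factorization V (n + 1) F"
    and "i \<in> {1..n + 1} \<Longrightarrow> num_maximal_cliques V (F i) \<le> n"
proof -
  have b_mem: "b i \<in> l0" if "i \<in> {1..n + 1}" for i using b that bij_betwE by blast
  have line_ne: "l \<noteq> l0" if "v \<in> V" "v \<in> l" for v l using that V_def by blast
  have pairs: "\<exists>u v. e = {u, v} \<and> u \<in> V \<and> v \<in> V \<and> u \<noteq> v" if "e \<in> [V]\<^bsup>2\<^esup>" for e
    using that by (auto simp: nsets_def card_2_iff)
  have F_sub: "F i \<subseteq> [V]\<^bsup>2\<^esup>" for i by (auto simp: F_def)
  have F_pair: "{u, v} \<in> F i \<longleftrightarrow>
      u \<in> V \<and> v \<in> V \<and> u \<noteq> v \<and> (\<exists>l \<in> lines. b i \<in> l \<and> u \<in> l \<and> v \<in> l)" for u v i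
    by (simp add: F_def mem_pairs_iff)
  show "complete_factorization V (n + 1) F"
    unfolding complete_factorization_def disjoint_family_on_def
  proof (intro conjI ballI impI subset_antisym)
    show "(\<Union>i\<in>{1..n + 1}. F i) \<subseteq> [V]\<^bsup>2\<^esup>" using F_sub by blast
  next
    show "[V]\<^bsup>2\<^esup> \<subseteq> (\<Union>i\<in>{1..n + 1}. F i)"
    proof
      fix e assume e: "e \<in> [V]\<^bsup>2\<^esup>"
      then obtain u v where uv: "e = {u, v}" "u \<in> V" "v \<in> V" "u \<noteq> v" using pairs by blast
      then obtain l where l: "l \<in> lines" "u \<in> l" "v \<in> l" using unique_line V_def by blast
      then obtain p where p: "p \<in> l" "p \<in> l0" using unique_meet l0 line_ne uv by blast
      then obtain i where "i \<in> {1..n + 1}" "b i = p" using b by (metis bij_betw_imp_surj_on imageE)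
      moreover from this have "{u, v} \<in> F i" using F_pair[of u v i] l p uv by blast
      ultimately show "e \<in> (\<Union>i\<in>{1..n + 1}. F i)" using uv(1) by blast
    qed
  next
    fix i j assume ij: "i \<in> {1..n + 1}" "j \<in> {1..n + 1}" "i \<noteq> j"
    have False if e: "e \<in> F i" "e \<in> F j" for e
    proof -
      obtain u v where uv: "e = {u, v}" "u \<in> V" "v \<in> V" "u \<noteq> v"
        using pairs[of e] F_sub e(1) by blast
      obtain l where l: "l \<in> lines" "b i \<in> l" "u \<in> l" "v \<in> l"
        using F_pair[of u v i] e(1) unfolding uv(1) by blast
      obtain k where k: "k \<in> lines" "b j \<in> k" "u \<in> k" "v \<in> k"
        using F_pair[of u v j] e(2) unfolding uv(1) by blast
      have "l = k" by (rule line_eqI[OF l(1) k(1) uv(4) l(3) k(3) l(4) k(4)])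
      moreover have "b i \<noteq> b j" using b ij by (metis bij_betw_imp_inj_on inj_onD)
      ultimately have "l = l0"
        using line_eqI[OF l(1) l0, of "b i" "b j"] l(2) k(2) b_mem[OF ij(1)] b_mem[OF ij(2)] by simp
      then show False using line_ne[OF uv(2) l(3)] by simp
    qed
    then show "F i \<inter> F j \<subseteq> {}" by blast
  qed simp
  assume i: "i \<in> {1..n + 1}"
  let ?K = "{l \<in> lines. b i \<in> l} - {l0}"
  have p: "b i \<in> points" using b_mem[OF i] l0 lines_subset by blast
  have V_ne: "V \<noteq> {}" using exists_point_off_line[OF l0] V_def by blast
  have "C \<in> (\<lambda>l. l \<inter> V) ` ?K" if C: "C \<in> maximal_cliques V (F i)" for C
  proof -
    obtain x where x: "x \<in> C" using maximal_clique_nonempty[OF V_ne C] by blast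
    have CV: "C \<subseteq> V" "clique C (F i)" using maximal_cliqueD[OF C] .
    have x_ne: "x \<noteq> b i" using x CV b_mem[OF i] V_def by blast
    have "x \<in> points" using x CV(1) by (auto simp: V_def)
    from ex1_implies_ex[OF unique_line[OF this p x_ne]]
    obtain l where l: "l \<in> lines" "x \<in> l" "b i \<in> l" by (elim exE conjE)
    have "y \<in> l" if y: "y \<in> C" "y \<noteq> x" for y
    proof -
      have "{x, y} \<in> F i"
        using CV(2)[unfolded clique_def, rule_format, OF x y(1)] y(2) by simp
      then obtain k where k: "k \<in> lines" "b i \<in> k" "x \<in> k" "y \<in> k"
        unfolding F_pair by (elim conjE bexE)
      have "l = k" by (rule line_eqI[OF l(1) k(1) x_ne l(2) k(3) l(3) k(2)])
      then show ?thesis using k(4) by simp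
    qed
    then have "C \<subseteq> l \<inter> V" using CV l by blast
    moreover have "clique (l \<inter> V) (F i)"
      using l by (auto simp: clique_def F_pair)
    ultimately have "l \<inter> V = C" using C by (simp add: maximal_cliques_def)
    moreover have "l \<noteq> l0" using line_ne l x CV by blast
    ultimately show ?thesis using l by blast
  qed
  then have "num_maximal_cliques V (F i) \<le> card ?K"
    unfolding num_maximal_cliques_def using finite_lines by (intro surj_card_le) auto
  also have "\<dots> = n" using card_pencil[OF p n] l0 b_mem[OF i] by simp
  finally show "num_maximal_cliques V (F i) \<le> n" .
qed

end

text \<open>
  The minimum defining \<open>f2\<close> is over graphs on \<open>{..<n\<^sup>2}\<close>. The plane is therefore first relabelled so
  that \<open>{..<n\<^sup>2}\<close> are the points off a line \<open>l0\<close> and the next \<open>n + 1\<close> numbers are the points of \<open>l0\<close>.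
\<close>

lemma f2_le_of_projective_plane:
  fixes P :: "'a set"
  assumes plane: "projective_plane P L n" and n: "n > 0"
  shows "f2 (n + 1) (n\<^sup>2) \<le> n\<^sup>2 + n"
proof -
  interpret projective_plane P L n by fact
  obtain l0 where l0: "l0 \<in> L" using exists_line by blast
  have l0P: "l0 \<subseteq> P" using lines_subset[OF l0] .
  have card_V: "card (P - l0) = n\<^sup>2"
    using card_Diff_subset[OF finite_line[OF l0] l0P] card_points card_line[OF l0] by simp
  obtain g :: "'a \<Rightarrow> nat" where g: "bij_betw g (P - l0) {..<n\<^sup>2}"
    using finite_same_card_bij[of "P - l0" "{..<n\<^sup>2}"] card_V finite_points by auto
  obtain h :: "'a \<Rightarrow> nat" where h: "bij_betw h l0 {n\<^sup>2..<n\<^sup>2 + n + 1}"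
    using finite_same_card_bij[of l0 "{n\<^sup>2..<n\<^sup>2 + n + 1}"] card_line[OF l0] finite_line[OF l0] by auto
  define r :: "'a \<Rightarrow> nat" where "r x = (if x \<in> P - l0 then g x else h x)" for x
  have "bij_betw r ((P - l0) \<union> l0) ({..<n\<^sup>2} \<union> {n\<^sup>2..<n\<^sup>2 + n + 1})"
    unfolding r_def by (rule bij_betw_disjoint_Un[OF g h]) auto
  moreover have "(P - l0) \<union> l0 = P" using l0P by blast
  ultimately have r: "inj_on r P" using bij_betw_imp_inj_on by metis
  have r_V: "r ` (P - l0) = {..<n\<^sup>2}"
    using g bij_betw_imp_surj_on[OF g] by (simp add: r_def)
  have r_l0: "r ` l0 = {n\<^sup>2..<n\<^sup>2 + n + 1}"
    using bij_betw_imp_surj_on[OF h] by (simp add: r_def)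
  have V: "r ` P - r ` l0 = {..<n\<^sup>2}"
    using r_V inj_on_image_set_diff[OF r, of P l0] l0P by auto
  interpret image: projective_plane "r ` P" "(`) r ` L" n
    by (rule projective_plane_image[OF plane r])
  \<comment> \<open>The factors are numbered from 1 on.\<close>
  define b where "b i = n\<^sup>2 + i - 1" for i :: nat
  have "bij_betw b {1..n + 1} (r ` l0)"
    unfolding r_l0 by (rule bij_betw_byWitness[where f' = "\<lambda>k. k + 1 - n\<^sup>2"]) (auto simp: b_def)
  note factorization = image.parallel_class_factorization[OF n _ this, unfolded V]
  have l0': "r ` l0 \<in> (`) r ` L" using l0 by blast
  let ?F = "\<lambda>i. {e \<in> [{..<n\<^sup>2}]\<^bsup>2\<^esup>. \<exists>l \<in> (`) r ` L. b i \<in> l \<and> e \<subseteq> l}"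
  have "f2 (n + 1) (n\<^sup>2) \<le> (\<Sum>i=1..n + 1. num_maximal_cliques {..<n\<^sup>2} (?F i))"
    by (rule f2_le[OF factorization(1)[OF l0']])
  also have "\<dots> \<le> (\<Sum>i=1..n + 1. n)" by (rule sum_mono) (rule factorization(2)[OF l0'])
  also have "\<dots> = n\<^sup>2 + n" by (simp add: power2_eq_square)
  finally show ?thesis .
qed

section \<open>The equivalence\<close>

theorem theorem20:
  fixes n :: nat
  assumes "n \<ge> 2"
  shows "(f2 (n + 1) (n ^ 2) = n ^ 2 + n \<longleftrightarrow> f2 (n + 1) (n ^ 2) \<le> n ^ 2 + n) \<and>
         (f2 (n + 1) (n ^ 2) \<le> n ^ 2 + n \<longleftrightarrow> exists_projective_plane n)"
proof -
  have n: "n > 0" using assms by simp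
  obtain F where F: "complete_factorization {..<n\<^sup>2} (n + 1) F"
      "f2 (n + 1) (n\<^sup>2) = (\<Sum>i=1..n + 1. num_maximal_cliques {..<n\<^sup>2} (F i))"
    using f2_attained[of "n + 1" "n\<^sup>2"] by auto
  have V: "finite {..<n\<^sup>2}" "card {..<n\<^sup>2} = n\<^sup>2" by simp_all
  note bound = factorization_bound[OF V n F(1), folded F(2)]
  have "n\<^sup>2 + n \<le> f2 (n + 1) (n\<^sup>2)" by (rule bound(1))
  moreover have "exists_projective_plane n" if le: "f2 (n + 1) (n\<^sup>2) \<le> n\<^sup>2 + n"
  proof -
    have "\<exists>(P :: (nat + nat) set) L. projective_plane P L n"
      by (rule projective_plane_of_extremal_factorization[OF V assms F(1)]) (rule bound(2)[OF le])
    then show ?thesis using exists_projective_planeI by blast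
  qed
  moreover have "f2 (n + 1) (n\<^sup>2) \<le> n\<^sup>2 + n" if "exists_projective_plane n"
    using that f2_le_of_projective_plane[OF _ n] unfolding exists_projective_plane_def by blast
  ultimately show ?thesis by auto
qed

end
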